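(* Let $C(P,L)$ be a framed cycle in general position in $\mathbb{R}P^2$ with $P=(p_1,\dots,p_k)$, $L=(\ell_1,\dots,\ell_k)$, $k\ge 3$. Let $\ell$ be a line that does not contain the intersection point of (the lines through) any pair of distinct edges of $C(P,L)$, and let $1\le i\le k$. Then the monodromy operator $M_\ell(\ell_i,C(P,L))$ is trivial if and only if there exists a nonzero equilibrium force-load for $C(P,L)$.
   Context: All indices are mod $k$. **Forces.** A force in $\mathbb{R}P^2$ is an exterior 2-form in $\Lambda^2(\mathbb{R}^3)$ (all such forms are decomposable). For $p=(a_1,a_2,a_3)$ put $dp=a_1dx_1+a_2dx_2+a_3dx_3$. A nonzero force equals $dp\wedge dq$ with $p,q$ linearly independent; its line of force is the projective line through the points represented by $p$ and $q$. The zero force is allowed wherever a force with a prescribed line of force is required. **Framed cycles.** A framed cycle $C(P,L)$ consists of points $p_1,\dots,p_k\in\mathbb{R}P^2$ (vertices of a cycle with edges $p_ip_{i+1}$) and lines $\ell_i\ni p_i$. It is in general position if (1) the $k$ lines $p_ip_{i+1}$ are in general position, i.e. their pairwise intersections form a discrete set of exactly $k(k-1)/2$ distinct points; (2) for every $i$, $\ell_i$ contains neither $p_{i-1}$ nor $p_{i+1}$. **Force-loads.** A force-load on $C(P,L)$ assigns forces $F_{i,i+1}=-F_{i+1,i}$ with line of force $p_ip_{i+1}$ to each edge and framing forces $F_i$ with line of force $\ell_i$ to each vertex. It is an equilibrium force-load if $F_{i,i-1}+F_{i,i+1}+F_i=0$ for every $i$. **Monodromy.** For a line $\ell$ containing no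 vertex of the cycle, the shift operator $\xi_\ell[p_ip_{i+1},\ell_i,\ell_{i+1}]:\ell_i\to\ell_{i+1}$ sends $p\in\ell_i$ to the intersection of $\ell_{i+1}$ with the line through $p$ and $p_ip_{i+1}\cap\ell$. The monodromy $M_\ell(\ell_i,C(P,L)):\ell_i\to\ell_i$ is the composition of the shift operators along the closed path $p_ip_{i+1}\dots p_{i-1}p_i$. It is trivial if it is the identity map of $\ell_i$. *)

theory Defs
  imports "HOL-Analysis.Analysis" "HOL-Library.Function_Algebras"
begin

section \<open>The real projective plane\<close>

text \<open>Points and lines of the projective plane are the one- and two-dimensional linear subspaces
  of \<open>\<real>\<^sup>3\<close>. Incidence is inclusion, and the common point of two distinct lines is their
  intersection as subspaces.\<close>

definition proj_point :: "(real^3) set \<Rightarrow> bool" where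
  "proj_point x \<longleftrightarrow> subspace x \<and> dim x = 1"

definition proj_line :: "(real^3) set \<Rightarrow> bool" where
  "proj_line m \<longleftrightarrow> subspace m \<and> dim m = 2"

definition line_through :: "(real^3) set \<Rightarrow> (real^3) set \<Rightarrow> (real^3) set" where
  "line_through x y = span (x \<union> y)"

section \<open>Forces\<close>

text \<open>Elements of \<open>\<Lambda>\<^sup>2(\<real>\<^sup>3)\<close> are alternating bilinear forms on \<open>\<real>\<^sup>3\<close>, with the
  pointwise vector space operations.\<close>

type_synonym form1 = "real^3 \<Rightarrow> real"
type_synonym form2 = "real^3 \<Rightarrow> real^3 \<Rightarrow> real"

definition is_force :: "form2 \<Rightarrow> bool" where
  "is_force F \<longleftrightarrow> bilinear F \<and> (\<forall>u. F u u = 0)"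

definition dform :: "real^3 \<Rightarrow> form1" where
  "dform a = (\<lambda>u. \<Sum>j\<in>UNIV. a $ j * u $ j)"

definition wedge :: "form1 \<Rightarrow> form1 \<Rightarrow> form2" where
  "wedge \<alpha> \<beta> = (\<lambda>u v. \<alpha> u * \<beta> v - \<alpha> v * \<beta> u)"

text \<open>The zero force is admitted for every prescribed line. The condition \<open>a \<noteq> b\<close> is needed
  because \<open>{a, b}\<close> collapses to a singleton when \<open>a = b\<close>.\<close>

definition has_line_of_force :: "form2 \<Rightarrow> (real^3) set \<Rightarrow> bool" where
  "has_line_of_force F m \<longleftrightarrow> is_force F \<and>
     (F = 0 \<or>
      (\<exists>a b. a \<noteq> b \<and> independent {a, b} \<and> F = wedge (dform a) (dform b) \<and> m = span {a, b}))"

section \<open>Framed cycles\<close>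

text \<open>The indices \<open>1, \<dots>, k\<close> modulo \<open>k\<close> are represented by \<open>0, \<dots>, k - 1\<close>; values of the
  families at other indices are irrelevant.\<close>

definition next_idx :: "nat \<Rightarrow> nat \<Rightarrow> nat" where
  "next_idx k i = (i + 1) mod k"

definition prev_idx :: "nat \<Rightarrow> nat \<Rightarrow> nat" where
  "prev_idx k i = (i + k - 1) mod k"

definition edge_line :: "nat \<Rightarrow> (nat \<Rightarrow> (real^3) set) \<Rightarrow> nat \<Rightarrow> (real^3) set" where
  "edge_line k P i = line_through (P i) (P (next_idx k i))"

definition framed_cycle :: "nat \<Rightarrow> (nat \<Rightarrow> (real^3) set) \<Rightarrow> (nat \<Rightarrow> (real^3) set) \<Rightarrow> bool" where
  "framed_cycle k P L \<longleftrightarrow> (\<forall>i<k. proj_point (P i) \<and> proj_line (L i) \<and> P i \<subseteq> L i)"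

definition edge_intersections :: "nat \<Rightarrow> (nat \<Rightarrow> (real^3) set) \<Rightarrow> (real^3) set set" where
  "edge_intersections k P =
     {x. proj_point x \<and> (\<exists>i<k. \<exists>j<k. i \<noteq> j \<and> x \<subseteq> edge_line k P i \<and> x \<subseteq> edge_line k P j)}"

definition general_position ::
    "nat \<Rightarrow> (nat \<Rightarrow> (real^3) set) \<Rightarrow> (nat \<Rightarrow> (real^3) set) \<Rightarrow> bool" where
  "general_position k P L \<longleftrightarrow>
     (\<forall>i<k. proj_line (edge_line k P i)) \<and>
     finite (edge_intersections k P) \<and> card (edge_intersections k P) = k * (k - 1) div 2 \<and>
     (\<forall>i<k. \<not> P (prev_idx k i) \<subseteq> L i \<and> \<not> P (next_idx k i) \<subseteq> L i)"

section \<open>Force-loads\<close>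

text \<open>\<open>F i j\<close> is the edge force \<open>F\<^bsub>i,j\<^esub>\<close>, relevant only for cyclically adjacent \<open>i, j\<close>,
  and \<open>G i\<close> is the framing force at vertex \<open>i\<close>.\<close>

definition force_load ::
    "nat \<Rightarrow> (nat \<Rightarrow> (real^3) set) \<Rightarrow> (nat \<Rightarrow> (real^3) set) \<Rightarrow>
     (nat \<Rightarrow> nat \<Rightarrow> form2) \<Rightarrow> (nat \<Rightarrow> form2) \<Rightarrow> bool" where
  "force_load k P L F G \<longleftrightarrow>
     (\<forall>i<k. has_line_of_force (F i (next_idx k i)) (edge_line k P i) \<and>
            F i (next_idx k i) = - F (next_idx k i) i \<and>
            has_line_of_force (G i) (L i))"

definition equilibrium_force_load ::
    "nat \<Rightarrow> (nat \<Rightarrow> (real^3) set) \<Rightarrow> (nat \<Rightarrow> (real^3) set) \<Rightarrow>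
     (nat \<Rightarrow> nat \<Rightarrow> form2) \<Rightarrow> (nat \<Rightarrow> form2) \<Rightarrow> bool" where
  "equilibrium_force_load k P L F G \<longleftrightarrow> force_load k P L F G \<and>
     (\<forall>i<k. F i (prev_idx k i) + F i (next_idx k i) + G i = 0)"

definition nonzero_force_load ::
    "nat \<Rightarrow> (nat \<Rightarrow> nat \<Rightarrow> form2) \<Rightarrow> (nat \<Rightarrow> form2) \<Rightarrow> bool" where
  "nonzero_force_load k F G \<longleftrightarrow> (\<exists>i<k. F i (next_idx k i) \<noteq> 0 \<or> G i \<noteq> 0)"

section \<open>Monodromy\<close>

text \<open>\<open>shift_op l e b\<close> is the shift operator \<open>\<xi>\<^sub>l[e, a, b]\<close> along the edge line \<open>e\<close> with values
  on the line \<open>b\<close>. Its domain, the set of points of the line \<open>a\<close>, does not enter the formula.\<close>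

definition shift_op ::
    "(real^3) set \<Rightarrow> (real^3) set \<Rightarrow> (real^3) set \<Rightarrow> (real^3) set \<Rightarrow> (real^3) set" where
  "shift_op l e b x = line_through x (e \<inter> l) \<inter> b"

text \<open>The composition of the shift operators along the first \<open>n\<close> edges of the path starting at
  vertex \<open>i\<close>.\<close>

primrec shift_along ::
    "nat \<Rightarrow> (nat \<Rightarrow> (real^3) set) \<Rightarrow> (nat \<Rightarrow> (real^3) set) \<Rightarrow> (real^3) set \<Rightarrow>
     nat \<Rightarrow> nat \<Rightarrow> (real^3) set \<Rightarrow> (real^3) set" where
  "shift_along k P L l i 0 = id"
| "shift_along k P L l i (Suc n) =
     shift_op l (edge_line k P ((i + n) mod k)) (L (next_idx k ((i + n) mod k)))
       \<circ> shift_along k P L l i n"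

definition monodromy ::
    "nat \<Rightarrow> (nat \<Rightarrow> (real^3) set) \<Rightarrow> (nat \<Rightarrow> (real^3) set) \<Rightarrow> (real^3) set \<Rightarrow>
     nat \<Rightarrow> (real^3) set \<Rightarrow> (real^3) set" where
  "monodromy k P L l i = shift_along k P L l i k"

definition trivial_monodromy ::
    "nat \<Rightarrow> (nat \<Rightarrow> (real^3) set) \<Rightarrow> (nat \<Rightarrow> (real^3) set) \<Rightarrow> (real^3) set \<Rightarrow>
     nat \<Rightarrow> bool" where
  "trivial_monodromy k P L l i \<longleftrightarrow>
     (\<forall>x. proj_point x \<and> x \<subseteq> L i \<longrightarrow> monodromy k P L l i x = x)"

end

theory Submission
  imports Defs
begin

text \<open>Send \<open>l\<close> to infinity and represent the vertices by vectors \<open>v\<^sub>j\<close> in an affine plane parallel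
  to it. The edge \<open>j\<close> then meets \<open>l\<close> in \<open>q\<^sub>j = v\<^sub>j\<^sub>+\<^sub>1 - v\<^sub>j\<close>, and the framing line with normal \<open>n\<^sub>j\<close>
  meets it in \<open>w\<^sub>j\<close>. The shift operators are induced by linear maps with \<open>v\<^sub>j \<mapsto> v\<^sub>j\<^sub>+\<^sub>1\<close> and
  \<open>w\<^sub>j \<mapsto> (s\<^sub>j / t\<^sub>j) w\<^sub>j\<^sub>+\<^sub>1\<close>, where \<open>s\<^sub>j = n\<^sub>j \<bullet> q\<^sub>j\<close> and \<open>t\<^sub>j = n\<^sub>j\<^sub>+\<^sub>1 \<bullet> q\<^sub>j\<close>, so the monodromy is trivial iff
  the product of all \<open>s\<^sub>j / t\<^sub>j\<close> is \<open>1\<close>. On the other hand, edge forces \<open>c\<^sub>j (v\<^sub>j \<times> v\<^sub>j\<^sub>+\<^sub>1)\<close> can be balanced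
  by framing forces iff \<open>c\<^sub>j\<^sub>+\<^sub>1 s\<^sub>j\<^sub>+\<^sub>1 = c\<^sub>j t\<^sub>j\<close> for all \<open>j\<close>; going once around the cycle, this
  recurrence has a nonzero solution under the same condition.\<close>

unbundle cross3_syntax

section \<open>Linear subspaces of \<open>\<real>\<^sup>3\<close> via the cross product\<close>

lemma cross3_eq_0_imp_scaleR:
  fixes n y :: "real^3"
  assumes "n \<times> y = 0" "n \<noteq> 0"
  shows "\<exists>c. y = c *\<^sub>R n"
proof -
  have "(n \<bullet> n) *\<^sub>R y = (n \<bullet> y) *\<^sub>R n"
    using Lagrange[of n n y] assms by simp
  then have "y = ((n \<bullet> y) / (n \<bullet> n)) *\<^sub>R n"
    using assms by (metis divideR_right divide_inverse_commute inner_eq_zero_iff scaleR_scaleR)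
  then show ?thesis by blast
qed

text \<open>Lagrange's formula expands \<open>n \<times> (a \<times> b)\<close> into multiples of
  \<open>n \<bullet> b\<close> and \<open>n \<bullet> a\<close>, both zero, so
  \<open>a \<times> b\<close> is parallel to \<open>n\<close>.\<close>

lemma cross3_cross3_hyperplane:
  fixes n a b :: "real^3"
  assumes "n \<bullet> a = 0" "n \<bullet> b = 0" "n \<noteq> 0"
  shows "\<exists>c. a \<times> b = c *\<^sub>R n"
  using cross3_eq_0_imp_scaleR[of n "a \<times> b"] assms by (simp add: Lagrange)

lemma span_pair_iff: "x \<in> span {a, b} \<longleftrightarrow> (\<exists>s t. x = s *\<^sub>R a + t *\<^sub>R b)"
  for x :: "'a::real_vector"
  by (simp add: span_breakdown_eq span_singleton image_iff diff_eq_eq add.commute)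

lemma span_singleton_subset_hyperplane: "span {x} \<subseteq> {y. n \<bullet> y = 0} \<longleftrightarrow> n \<bullet> x = 0"
  using span_base[of x "{x}"] span_minimal[of "{x}" "{y. n \<bullet> y = 0}"]
  by (auto simp: subspace_hyperplane)

lemma span_pair_eq_hyperplane:
  fixes a b :: "real^3"
  assumes "a \<times> b \<noteq> 0"
  shows "span {a, b} = {x. (a \<times> b) \<bullet> x = 0}"
proof (intro equalityI subsetI CollectI)
  fix x assume "x \<in> span {a, b}"
  then show "(a \<times> b) \<bullet> x = 0"
    by (auto simp: span_pair_iff inner_add_right dot_cross_self)
next
  fix x assume "x \<in> {x. (a \<times> b) \<bullet> x = 0}"
  then have x: "(a \<times> b) \<bullet> x = 0" by simp
  define D where "D = (a \<times> b) \<bullet> (a \<times> b)"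
  \<comment> \<open>Cramer's rule for \<open>x\<close> in the basis \<open>a\<close>,
    \<open>b\<close>, \<open>a \<times> b\<close>, multiplied by its determinant
    \<open>D\<close>.\<close>
  have "D *\<^sub>R x = ((x \<times> b) \<bullet> (a \<times> b)) *\<^sub>R a + ((a \<times> x) \<bullet> (a \<times> b)) *\<^sub>R b
      + ((a \<times> b) \<bullet> x) *\<^sub>R (a \<times> b)"
    unfolding D_def by (simp add: cross3_def inner_vec_def sum_3 vec_eq_iff forall_3 algebra_simps)
  then have "D *\<^sub>R x = ((x \<times> b) \<bullet> (a \<times> b)) *\<^sub>R a + ((a \<times> x) \<bullet> (a \<times> b)) *\<^sub>R b"
    by (simp add: x)
  then have "D *\<^sub>R x \<in> span {a, b}"
    unfolding span_pair_iff by blast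
  then have "(1 / D) *\<^sub>R (D *\<^sub>R x) \<in> span {a, b}"
    by (rule span_scale)
  moreover have "D \<noteq> 0" using assms by (simp add: D_def)
  ultimately show "x \<in> span {a, b}" by simp
qed

lemma independent_pair_iff_cross3:
  fixes a b :: "real^3"
  shows "a \<noteq> b \<and> independent {a, b} \<longleftrightarrow> a \<times> b \<noteq> 0"
proof
  assume ab: "a \<noteq> b \<and> independent {a, b}"
  show "a \<times> b \<noteq> 0"
  proof
    assume "a \<times> b = 0"
    moreover have "a \<noteq> 0" using ab dependent_zero by blast
    ultimately obtain c where "b = c *\<^sub>R a"
      using cross3_eq_0_imp_scaleR by blast
    then have "b \<in> span {a}" by (auto simp: span_singleton)
    moreover have "independent (insert b {a})"
      using ab by (simp add: insert_commute)
    ultimately show False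
      using ab by (auto simp: independent_insert)
  qed
next
  assume ab: "a \<times> b \<noteq> 0"
  then have "a \<notin> span {b}" by (auto simp: span_singleton cross_mult_left)
  moreover have "b \<noteq> 0" using ab by auto
  ultimately show "a \<noteq> b \<and> independent {a, b}"
    using ab by (auto simp: independent_insert)
qed

lemma proj_point_iff: "proj_point x \<longleftrightarrow> (\<exists>v. v \<noteq> 0 \<and> x = span {v})"
proof
  assume x: "proj_point x"
  then obtain B where B: "B \<subseteq> x" "independent B" "x \<subseteq> span B" "card B = 1"
    unfolding proj_point_def by (metis basis_exists)
  then obtain v where v: "B = {v}" by (auto simp: card_1_singleton_iff)
  have "x = span {v}"
    using B v x span_subspace unfolding proj_point_def by blast
  moreover have "v \<noteq> 0" using B v by auto
  ultimately show "\<exists>v. v \<noteq> 0 \<and> x = span {v}" by blast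
next
  assume "\<exists>v. v \<noteq> 0 \<and> x = span {v}"
  then obtain v where v: "v \<noteq> 0" "x = span {v}" by blast
  then have "dim x = card {v}" by (metis dim_span_eq_card_independent independent_insert
      independent_empty span_empty singletonD empty_iff)
  then show "proj_point x" by (simp add: v proj_point_def)
qed

lemma proj_line_span_pair:
  assumes "proj_line m"
  obtains a b where "a \<times> b \<noteq> 0" "m = span {a, b}"
proof -
  obtain B where B: "B \<subseteq> m" "independent B" "m \<subseteq> span B" "card B = 2"
    using assms unfolding proj_line_def by (metis basis_exists)
  then obtain a b where ab: "B = {a, b}" "a \<noteq> b" by (auto simp: card_2_iff)
  moreover have "m = span B"
    using B assms span_subspace unfolding proj_line_def by blast
  ultimately show thesis
    using that B independent_pair_iff_cross3 by metis
qed

lemma proj_line_span: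
  assumes "a \<times> b \<noteq> 0"
  shows "proj_line (span {a, b})"
proof -
  have "a \<noteq> b" "independent {a, b}" using assms independent_pair_iff_cross3 by auto
  then have "dim (span {a, b}) = 2"
    using dim_span_eq_card_independent[of "{a, b}"] by simp
  then show ?thesis by (simp add: proj_line_def)
qed

lemma line_through_span: "line_through (span {x}) (span {y}) = span {x, y}"
  unfolding line_through_def
proof (intro equalityI span_minimal)
  show "span {x} \<union> span {y} \<subseteq> span {x, y}"
    by (simp add: span_mono)
  show "{x, y} \<subseteq> span (span {x} \<union> span {y})"
    by (auto intro!: span_base)
qed simp_all

lemma proj_line_hyperplane:
  assumes "proj_line m"
  obtains n where "n \<noteq> 0" "m = {x. n \<bullet> x = 0}"
  using assms by (metis proj_line_span_pair span_pair_eq_hyperplane)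

text \<open>In general position the set of edge intersections is finite, so this rules out two edges
  sharing a line.\<close>

lemma infinite_points_on_line:
  assumes "proj_line e"
  shows "infinite {x. proj_point x \<and> x \<subseteq> e}"
proof -
  obtain a b where ab: "a \<times> b \<noteq> 0" "e = span {a, b}"
    using assms by (rule proj_line_span_pair)
  \<comment> \<open>The cross product of the representatives at two parameters is
    \<open>a \<times> b\<close> times the difference of the parameters, which separates the
    points.\<close>
  define f where "f t = span {a + real t *\<^sub>R b}" for t
  have cr: "(a + s *\<^sub>R b) \<times> (a + t *\<^sub>R b) = (t - s) *\<^sub>R (a \<times> b)" for s t
    by (simp add: cross_add_left cross_add_right cross_mult_left cross_mult_right
        scaleR_left_diff_distrib) (simp add: cross_skew[of b a])
  have nz: "a + s *\<^sub>R b \<noteq> 0" for s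
    using cr[of s "s + 1"] ab by auto
  have "inj f"
  proof (rule injI)
    fix s t assume "f s = f t"
    then have "a + real s *\<^sub>R b \<in> span {a + real t *\<^sub>R b}"
      unfolding f_def by (metis insertI1 span_base)
    then obtain c where "a + real s *\<^sub>R b = c *\<^sub>R (a + real t *\<^sub>R b)"
      by (auto simp: span_singleton)
    then have "(a + real s *\<^sub>R b) \<times> (a + real t *\<^sub>R b) = 0"
      by (metis cross_mult_left cross_refl scale_zero_right)
    then show "s = t" using ab by (simp add: cr)
  qed
  moreover have "range f \<subseteq> {x. proj_point x \<and> x \<subseteq> e}"
  proof clarsimp
    fix t
    have "a + real t *\<^sub>R b \<in> e" unfolding ab span_pair_iff
      by (metis scaleR_one)
    then have "f t \<subseteq> e"
      unfolding f_def ab by (metis empty_subsetI insert_subset span_mono span_span)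
    then show "proj_point (f t) \<and> f t \<subseteq> e"
      using nz by (auto simp: proj_point_iff f_def)
  qed
  ultimately show ?thesis
    using finite_subset range_inj_infinite by blast
qed

section \<open>Forces as vectors\<close>

text \<open>The contraction of the volume form with \<open>c\<close>, identifying vectors with
  alternating 2-forms. It turns the wedge of \<open>dform a\<close> and \<open>dform b\<close> into
  \<open>a \<times> b\<close>, so that equilibrium becomes vector algebra.\<close>

definition cross_form :: "real^3 \<Rightarrow> form2" where
  "cross_form c = (\<lambda>u v. c \<bullet> (u \<times> v))"

lemma wedge_dform: "wedge (dform a) (dform b) = cross_form (a \<times> b)"
  by (intro ext) (simp add: wedge_def dform_def cross_form_def cross3_simps)

lemma cross_form_add: "cross_form (a + b) = cross_form a + cross_form b"
  by (intro ext) (simp add: cross_form_def inner_add_left)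

lemma cross_form_minus: "cross_form (- a) = - cross_form a"
  by (intro ext) (simp add: cross_form_def)

lemma cross_form_eq_0_iff [simp]: "cross_form c = 0 \<longleftrightarrow> c = 0"
proof
  assume "cross_form c = 0"
  then have c: "c \<bullet> (u \<times> v) = 0" for u v by (metis cross_form_def zero_fun_apply)
  show "c = 0"
    \<comment> \<open>Evaluating on pairs of basis vectors reads off the coordinates of
      \<open>c\<close>.\<close>
    using c[of "axis 2 1" "axis 3 1"] c[of "axis 3 1" "axis 1 1"] c[of "axis 1 1" "axis 2 1"]
    by (simp add: cross_basis inner_axis vec_eq_iff forall_3)
qed (simp add: cross_form_def fun_eq_iff)

lemma is_force_cross_form: "is_force (cross_form c)"
  unfolding is_force_def cross_form_def
  by (auto simp: bilinear_def linear_iff cross_add_left cross_add_right cross_mult_left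
      cross_mult_right inner_add_right)

text \<open>Any two vectors on the line have a cross product parallel to its normal. Hence the
  forces with a prescribed line of force, together with zero, form a one-dimensional space and a
  single scalar describes each of them.\<close>

lemma has_line_of_force_iff:
  assumes "proj_line m" "n \<noteq> 0" "m = {x. n \<bullet> x = 0}"
  shows "has_line_of_force F m \<longleftrightarrow> (\<exists>c. F = cross_form (c *\<^sub>R n))"
proof
  assume "has_line_of_force F m"
  then consider "F = 0" | a b where "F = cross_form (a \<times> b)" "m = span {a, b}"
    unfolding has_line_of_force_def wedge_dform by blast
  then show "\<exists>c. F = cross_form (c *\<^sub>R n)"
  proof cases
    case 1
    then show ?thesis by (metis cross_form_eq_0_iff scaleR_zero_left)
  next
    case 2
    then have "a \<in> m" "b \<in> m" by (simp_all add: span_base)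
    then have "n \<bullet> a = 0" "n \<bullet> b = 0" using assms(3) by auto
    then show ?thesis
      using 2(1) cross3_cross3_hyperplane[OF _ _ assms(2)] by metis
  qed
next
  assume "\<exists>c. F = cross_form (c *\<^sub>R n)"
  then obtain c where c: "F = cross_form (c *\<^sub>R n)" ..
  obtain a b where ab: "a \<times> b \<noteq> 0" "m = span {a, b}"
    using assms(1) by (rule proj_line_span_pair)
  then have "a \<in> m" "b \<in> m" by (simp_all add: span_base)
  then have "n \<bullet> a = 0" "n \<bullet> b = 0" using assms(3) by auto
  then obtain d where d: "a \<times> b = d *\<^sub>R n"
    using cross3_cross3_hyperplane[OF _ _ assms(2)] by metis
  have "d \<noteq> 0" using d ab by auto
  show "has_line_of_force F m"
  proof (cases "c = 0")
    case True
    then show ?thesis using is_force_cross_form c by (simp add: has_line_of_force_def)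
  next
    case False
    \<comment> \<open>Rescaling one spanning vector adjusts the cross product from
      \<open>d *\<^sub>R n\<close> to exactly \<open>c *\<^sub>R n\<close> without changing the
      line.\<close>
    define a' where "a' = (c / d) *\<^sub>R a"
    have *: "a' \<times> b = c *\<^sub>R n"
      using \<open>d \<noteq> 0\<close> by (simp add: a'_def cross_mult_left d)
    have nz: "a' \<times> b \<noteq> 0" using False * assms by simp
    have "m = span {a', b}"
      unfolding span_pair_eq_hyperplane[OF nz] unfolding * assms using False by simp
    moreover have "F = wedge (dform a') (dform b)" by (simp add: wedge_dform * c)
    ultimately show ?thesis
      using nz independent_pair_iff_cross3 is_force_cross_form c
      unfolding has_line_of_force_def by metis
  qed
qed

text \<open>On representatives the shift is the linear projection along \<open>q\<close> onto the
  plane \<open>b\<close>: the coefficient of \<open>q\<close> is the one that makes the result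
  orthogonal to \<open>n\<close>.\<close>

lemma shift_op_span:
  assumes "n \<bullet> q \<noteq> 0" "e \<inter> l = span {q}" "b = {y. n \<bullet> y = 0}"
  shows "shift_op l e b (span {x}) = span {x - ((n \<bullet> x) / (n \<bullet> q)) *\<^sub>R q}"
    (is "_ = span {?y}")
proof -
  have "span {x, q} \<inter> b = span {?y}"
  proof (intro equalityI subsetI)
    fix z assume z: "z \<in> span {x, q} \<inter> b"
    then obtain s t where st: "z = s *\<^sub>R x + t *\<^sub>R q" by (auto simp: span_pair_iff)
    then have "s * (n \<bullet> x) + t * (n \<bullet> q) = 0"
      using z assms by (simp add: inner_add_right)
    then have "t = - (s * (n \<bullet> x) / (n \<bullet> q))" using assms(1) by (simp add: field_simps)
    then have "z = s *\<^sub>R ?y" using st by (simp add: algebra_simps)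
    then show "z \<in> span {?y}" by (auto simp: span_singleton)
  next
    fix z assume "z \<in> span {?y}"
    then obtain s where s: "z = s *\<^sub>R ?y" by (auto simp: span_singleton)
    then have "n \<bullet> z = 0" using assms(1) by (simp add: inner_diff_right)
    moreover have "?y \<in> span {x, q}"
      by (intro span_diff span_scale) (auto intro: span_base)
    then have "z \<in> span {x, q}" unfolding s by (rule span_scale)
    ultimately show "z \<in> span {x, q} \<inter> b" using assms(3) by simp
  qed
  then show ?thesis using assms by (simp add: shift_op_def line_through_span)
qed


section \<open>Normalised framed cycles\<close>

lemma periodic_mod:
  fixes f :: "nat \<Rightarrow> 'a"
  assumes "\<And>j. f (j + k) = f j"
  shows "f (j mod k) = f j"
proof -
  have "f (a + b * k) = f a" for a b
  proof (induction b)
    case (Suc b)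
    then show ?case using assms[of "a + b * k"] by (simp add: algebra_simps)
  qed simp
  from this[of "j mod k" "j div k"] show ?thesis by simp
qed

lemma next_idx_mod: "next_idx k (j mod k) = Suc j mod k"
  by (simp add: next_idx_def mod_Suc_eq)

lemma prev_idx_Suc_mod:
  assumes "k > 0"
  shows "prev_idx k (Suc j mod k) = j mod k"
proof (cases "Suc (j mod k) = k")
  case True
  then show ?thesis by (auto simp: prev_idx_def mod_Suc)
next
  case False
  then show ?thesis using assms by (simp add: prev_idx_def mod_Suc)
qed

text \<open>The two neighbours of a vertex are different, so an edge force and its reversal can be
  assigned consistently.\<close>

lemma Suc_Suc_mod_neq:
  assumes "k \<ge> 3"
  shows "Suc (Suc j) mod k \<noteq> j mod k"
  using assms by (simp add: mod_Suc)

text \<open>The representatives \<open>v\<close> of the vertices lie in the affine plane \<open>m \<bullet> x = 1\<close>, which makes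
  the line \<open>l\<close> the line at infinity; \<open>n\<close> are normal vectors of the framing lines. Periodic extension of the
  families from \<open>{..<k}\<close> to \<open>\<nat>\<close> avoids arithmetic modulo \<open>k\<close>.\<close>

locale normalised_framed_cycle =
  fixes k :: nat and v n :: "nat \<Rightarrow> real^3" and m :: "real^3"
    and P L :: "nat \<Rightarrow> (real^3) set" and l :: "(real^3) set"
  assumes k: "k \<ge> 3"
    and v_periodic: "v (j + k) = v j"
    and n_periodic: "n (j + k) = n j"
    and m_v: "m \<bullet> v j = 1"
    and n_v: "n j \<bullet> v j = 0"
    and n_v_Suc: "n j \<bullet> v (Suc j) \<noteq> 0"
    and n_Suc_v: "n (Suc j) \<bullet> v j \<noteq> 0"
    and P_eq: "j < k \<Longrightarrow> P j = span {v j}"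
    and L_eq: "j < k \<Longrightarrow> L j = {x. n j \<bullet> x = 0}"
    and L_line: "j < k \<Longrightarrow> proj_line (L j)"
    and l_eq: "l = {x. m \<bullet> x = 0}"
begin

definition q :: "nat \<Rightarrow> real^3" where "q j = v (Suc j) - v j"

text \<open>\<open>q j\<close> and \<open>w j\<close> represent the points at infinity of the \<open>j\<close>-th edge and framing line.\<close>

definition w :: "nat \<Rightarrow> real^3" where "w j = n j \<times> m"

definition s :: "nat \<Rightarrow> real" where "s j = n j \<bullet> q j"

definition t :: "nat \<Rightarrow> real" where "t j = n (Suc j) \<bullet> q j"

lemma k_pos: "k > 0"
  using k by simp

lemma s_eq: "s j = n j \<bullet> v (Suc j)"
  by (simp add: s_def q_def inner_diff_right n_v)

lemma t_eq: "t j = - (n (Suc j) \<bullet> v j)"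
  by (simp add: t_def q_def inner_diff_right n_v)

lemma s_nonzero: "s j \<noteq> 0"
  by (simp add: s_eq n_v_Suc)

lemma t_nonzero: "t j \<noteq> 0"
  by (simp add: t_eq n_Suc_v)

lemma n_nonzero: "n j \<noteq> 0"
  using n_v_Suc[of j] by auto

lemma v_nonzero: "v j \<noteq> 0"
  using m_v[of j] by auto

lemma s_periodic: "s (j + k) = s j"
  using v_periodic[of "Suc j"] by (simp add: s_eq n_periodic)

lemma t_periodic: "t (j + k) = t j"
  using n_periodic[of "Suc j"] by (simp add: t_eq v_periodic)

lemma w_periodic: "w (j + k) = w j"
  by (simp add: w_def n_periodic)

lemma v_mod: "v (j mod k) = v j"
  using v_periodic by (rule periodic_mod)

lemma n_mod: "n (j mod k) = n j"
  using n_periodic by (rule periodic_mod)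

lemma P_mod: "P (j mod k) = span {v j}"
  using k_pos by (simp add: P_eq v_mod)

lemma L_mod: "L (j mod k) = {x. n j \<bullet> x = 0}"
  using k_pos by (simp add: L_eq n_mod)

lemma edge_line_mod: "edge_line k P (j mod k) = span {v j, v (Suc j)}"
  by (simp add: edge_line_def next_idx_mod P_mod line_through_span)

section \<open>The monodromy in affine coordinates\<close>

lemma m_q: "m \<bullet> q j = 0"
  by (simp add: q_def inner_diff_right m_v)

lemma m_w: "m \<bullet> w j = 0"
  by (simp add: w_def dot_cross_self)

lemma edge_inter_l: "edge_line k P (j mod k) \<inter> l = span {q j}"
proof (intro equalityI subsetI)
  fix x assume x: "x \<in> edge_line k P (j mod k) \<inter> l"
  then obtain a b where ab: "x = a *\<^sub>R v j + b *\<^sub>R v (Suc j)"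
    by (auto simp: edge_line_mod span_pair_iff)
  \<comment> \<open>Under \<open>m\<close> both vertices have height one, while points of
    \<open>l\<close> have height zero.\<close>
  with x have "a = - b" by (simp add: l_eq inner_add_right m_v)
  then have "x = b *\<^sub>R q j" by (simp add: ab q_def algebra_simps)
  then show "x \<in> span {q j}" by (auto simp: span_singleton)
next
  fix x assume "x \<in> span {q j}"
  then obtain b where b: "x = b *\<^sub>R q j" by (auto simp: span_singleton)
  then have "x = (- b) *\<^sub>R v j + b *\<^sub>R v (Suc j)" by (simp add: q_def algebra_simps)
  then have "x \<in> edge_line k P (j mod k)"
    unfolding edge_line_mod span_pair_iff by blast
  then show "x \<in> edge_line k P (j mod k) \<inter> l" by (simp add: l_eq b m_q)
qed

text \<open>Since \<open>n j\<close> is nonzero, this makes \<open>v j\<close> and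
  \<open>w j\<close> independent; both lie on the framing line and serve as its basis.\<close>

lemma v_cross_w: "v j \<times> w j = n j"
  using m_v[of j] n_v[of j] by (simp add: w_def Lagrange inner_commute)

text \<open>Two evaluations of \<open>n (Suc j) \<times> (w j \<times> q j)\<close>: directly by
  Lagrange's formula, and after \<open>w j \<times> q j\<close> has been recognised as
  \<open>s j *\<^sub>R m\<close>.\<close>

lemma w_shift: "t j *\<^sub>R w j - (n (Suc j) \<bullet> w j) *\<^sub>R q j = s j *\<^sub>R w (Suc j)"
proof -
  have "w j \<times> q j = - (q j \<times> (n j \<times> m))"
    unfolding w_def by (rule cross_skew)
  also have "\<dots> = s j *\<^sub>R m"
    using m_q[of j] by (simp add: Lagrange s_def inner_commute)
  finally have "n (Suc j) \<times> (w j \<times> q j) = s j *\<^sub>R w (Suc j)"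
    by (simp add: cross_mult_right w_def)
  then show ?thesis by (simp add: Lagrange t_def)
qed

text \<open>The projection along \<open>q j\<close> sends \<open>v j\<close> to
  \<open>v j + q j\<close>, which is the next vertex, and \<open>w j\<close> to a multiple of
  \<open>w (Suc j)\<close> by the preceding identity. So the shift is diagonal in these
  bases.\<close>

lemma shift_op_edge:
  "shift_op l (edge_line k P (j mod k)) (L (Suc j mod k)) (span {a *\<^sub>R v j + b *\<^sub>R w j}) =
   span {a *\<^sub>R v (Suc j) + (b * (s j / t j)) *\<^sub>R w (Suc j)}" (is "?lhs = span {?y}")
proof -
  define x where "x = a *\<^sub>R v j + b *\<^sub>R w j"
  define d where "d = n (Suc j) \<bullet> w j"
  have t: "n (Suc j) \<bullet> q j \<noteq> 0"
    using t_nonzero by (simp add: t_def)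
  have "?lhs = span {x - ((n (Suc j) \<bullet> x) / (n (Suc j) \<bullet> q j)) *\<^sub>R q j}"
    unfolding x_def by (rule shift_op_span[OF t edge_inter_l L_mod])
  moreover have "n (Suc j) \<bullet> x = b * d - a * t j"
    by (simp add: x_def d_def t_eq inner_add_right)
  moreover have "w j - (d / t j) *\<^sub>R q j = (s j / t j) *\<^sub>R w (Suc j)"
  proof -
    have "(1 / t j) *\<^sub>R (t j *\<^sub>R w j - d *\<^sub>R q j) = (1 / t j) *\<^sub>R (s j *\<^sub>R w (Suc j))"
      unfolding d_def w_shift ..
    then show ?thesis using t_nonzero[of j] by (simp add: scaleR_right_diff_distrib)
  qed
  then have "x - ((b * d - a * t j) / t j) *\<^sub>R q j = ?y"
  proof -
    assume eq: "w j - (d / t j) *\<^sub>R q j = (s j / t j) *\<^sub>R w (Suc j)"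
    have "x - ((b * d - a * t j) / t j) *\<^sub>R q j
        = a *\<^sub>R (v j + q j) + b *\<^sub>R (w j - (d / t j) *\<^sub>R q j)"
      using t_nonzero[of j] by (simp add: x_def diff_divide_distrib algebra_simps)
    then show ?thesis unfolding eq by (simp add: q_def)
  qed
  ultimately show ?thesis by (simp add: t_def)
qed

lemma shift_along_eq:
  assumes "i < k"
  shows "shift_along k P L l i N (span {a *\<^sub>R v i + b *\<^sub>R w i}) =
    span {a *\<^sub>R v (i + N) + (b * (\<Prod>u<N. s (i + u) / t (i + u))) *\<^sub>R w (i + N)}"
proof (induction N)
  case (Suc N)
  then show ?case by (simp add: next_idx_mod shift_op_edge mult.assoc)
qed simp

lemma trivial_monodromy_iff:
  assumes "i < k"
  shows "trivial_monodromy k P L l i \<longleftrightarrow> (\<Prod>u<k. s (i + u) / t (i + u)) = 1"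
    (is "_ \<longleftrightarrow> ?B = 1")
proof -
  have mon: "monodromy k P L l i (span {a *\<^sub>R v i + b *\<^sub>R w i}) =
      span {a *\<^sub>R v i + (b * ?B) *\<^sub>R w i}" for a b
    using shift_along_eq[OF assms, of k a b] by (simp add: monodromy_def v_periodic w_periodic)
  have L: "x \<in> L i \<longleftrightarrow> n i \<bullet> x = 0" for x
    using assms by (simp add: L_eq)
  have n_w: "n i \<bullet> w i = 0" by (simp add: w_def dot_cross_self)
  show ?thesis
  proof
    assume triv: "trivial_monodromy k P L l i"
    \<comment> \<open>A diagonal map fixes the two coordinate points in any case; a point with both
      coordinates nonzero detects the ratio of the eigenvalues.\<close>
    define x where "x = v i + w i"
    have "v i \<times> x = n i" by (simp add: x_def cross_add_right v_cross_w)
    then have "x \<noteq> 0" using n_nonzero[of i] by auto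
    then have "proj_point (span {x})" by (auto simp: proj_point_iff)
    moreover have "span {x} \<subseteq> L i"
      by (auto simp: L span_singleton x_def inner_add_right n_v n_w)
    ultimately have "monodromy k P L l i (span {x}) = span {x}"
      using triv by (simp add: trivial_monodromy_def)
    then have "span {v i + ?B *\<^sub>R w i} = span {x}"
      using mon[of 1 1] by (simp add: x_def)
    then have "v i + ?B *\<^sub>R w i \<in> span {x}"
      using span_base[of "v i + ?B *\<^sub>R w i" "{v i + ?B *\<^sub>R w i}"] by simp
    then obtain c where c: "v i + ?B *\<^sub>R w i = c *\<^sub>R x"
      by (auto simp: span_singleton)
    \<comment> \<open>Heights under \<open>m\<close> determine the proportionality factor, because
      \<open>w i\<close> has height zero.\<close>
    then have "m \<bullet> (v i + ?B *\<^sub>R w i) = m \<bullet> (c *\<^sub>R x)" by simp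
    then have "c = 1" by (simp add: x_def inner_add_right m_v m_w)
    then have "(?B - 1) *\<^sub>R w i = 0" using c by (simp add: x_def algebra_simps)
    moreover have "w i \<noteq> 0" using v_cross_w[of i] n_nonzero[of i] by auto
    ultimately show "?B = 1" by simp
  next
    assume B: "?B = 1"
    show "trivial_monodromy k P L l i"
      unfolding trivial_monodromy_def
    proof (intro allI impI, elim conjE)
      fix x assume "proj_point x" "x \<subseteq> L i"
      then obtain y where y: "x = span {y}" "n i \<bullet> y = 0"
        using L span_base by (fastforce simp: proj_point_iff)
      \<comment> \<open>Removing the \<open>v i\<close> component leaves a vector orthogonal to both
        \<open>n i\<close> and \<open>m\<close>, hence parallel to \<open>w i\<close>.\<close>
      define z where "z = y - (m \<bullet> y) *\<^sub>R v i"
      have "z \<times> w i = 0"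
        using y by (simp add: w_def Lagrange z_def inner_diff_left inner_diff_right m_v n_v
            inner_commute[of _ m] inner_commute[of _ "n i"])
      then have "w i \<times> z = 0" by (metis cross_skew neg_equal_0_iff_equal)
      moreover have "w i \<noteq> 0" using v_cross_w[of i] n_nonzero[of i] by auto
      ultimately obtain b where "z = b *\<^sub>R w i" using cross3_eq_0_imp_scaleR by blast
      then have "y = (m \<bullet> y) *\<^sub>R v i + b *\<^sub>R w i" by (simp add: z_def algebra_simps)
      then show "monodromy k P L l i x = x"
        using mon[of "m \<bullet> y" b] B y by simp
    qed
  qed
qed

section \<open>Force-loads and the stress recurrence\<close>

definition edge_normal :: "nat \<Rightarrow> real^3" where
  "edge_normal j = v j \<times> v (Suc j)"

lemma edge_normal_nonzero: "edge_normal j \<noteq> 0"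
proof
  assume "edge_normal j = 0"
  then have "n j \<times> (v j \<times> v (Suc j)) = 0" by (simp add: edge_normal_def)
  then show False using n_v_Suc[of j] v_nonzero[of j] by (simp add: Lagrange n_v)
qed

lemma edge_normal_mod: "edge_normal (j mod k) = edge_normal j"
  using v_periodic[of "Suc _"] by (intro periodic_mod) (simp add: edge_normal_def v_periodic)

lemma edge_force_iff:
  "has_line_of_force F (edge_line k P (j mod k)) \<longleftrightarrow>
    (\<exists>c. F = cross_form (c *\<^sub>R edge_normal j))"
proof (rule has_line_of_force_iff)
  have nz: "v j \<times> v (Suc j) \<noteq> 0"
    using edge_normal_nonzero[of j] by (simp add: edge_normal_def)
  show "proj_line (edge_line k P (j mod k))"
    using nz by (simp add: edge_line_mod proj_line_span)
  show "edge_normal j \<noteq> 0" by (rule edge_normal_nonzero)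
  show "edge_line k P (j mod k) = {x. edge_normal j \<bullet> x = 0}"
    using span_pair_eq_hyperplane[OF nz] by (simp add: edge_line_mod edge_normal_def)
qed

lemma framing_force_iff:
  "has_line_of_force F (L (j mod k)) \<longleftrightarrow> (\<exists>g. F = cross_form (g *\<^sub>R n j))"
  using k_pos by (intro has_line_of_force_iff n_nonzero L_mod L_line) simp

text \<open>Both edge forces at the vertex \<open>p\<close> have the factor \<open>p\<close>, so
  their sum is \<open>p \<times> y\<close>. A framing force balances it iff it is parallel to the
  framing normal \<open>?n\<close>, and \<open>?n \<times> (p \<times> y)\<close> equals
  \<open>(?n \<bullet> y) *\<^sub>R p\<close> because \<open>?n\<close> is orthogonal to
  \<open>p\<close>.\<close>

lemma vertex_equilibrium_iff:
  "(\<exists>g. - cross_form (a *\<^sub>R edge_normal j) + cross_form (b *\<^sub>R edge_normal (Suc j))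
       + cross_form (g *\<^sub>R n (Suc j)) = 0) \<longleftrightarrow> b * s (Suc j) = a * t j"
proof -
  define p y where "p = v (Suc j)" and "y = a *\<^sub>R v j + b *\<^sub>R v (Suc (Suc j))"
  let ?n = "n (Suc j)"
  have "?n \<bullet> y = b * s (Suc j) - a * t j"
    by (simp add: y_def inner_add_right s_eq t_eq)
  moreover have "- (a *\<^sub>R edge_normal j) + b *\<^sub>R edge_normal (Suc j) = p \<times> y"
    by (simp add: edge_normal_def p_def y_def cross_add_right cross_mult_right
        cross_skew[of "v (Suc j)" "v j"])
  then have "(- cross_form (a *\<^sub>R edge_normal j) + cross_form (b *\<^sub>R edge_normal (Suc j))
       + cross_form (g *\<^sub>R ?n) = 0) \<longleftrightarrow> p \<times> y + g *\<^sub>R ?n = 0" for g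
    by (metis cross_form_add cross_form_eq_0_iff cross_form_minus)
  moreover have "(\<exists>g. p \<times> y + g *\<^sub>R ?n = 0) \<longleftrightarrow> ?n \<bullet> y = 0"
  proof
    assume "\<exists>g. p \<times> y + g *\<^sub>R ?n = 0"
    then obtain g where "p \<times> y = - g *\<^sub>R ?n" by (metis add_eq_0_iff2 scaleR_minus_left)
    then have "?n \<times> (p \<times> y) = 0" by (simp add: cross_mult_right)
    then have "(?n \<bullet> y) *\<^sub>R p = 0" by (simp add: Lagrange p_def n_v)
    then show "?n \<bullet> y = 0" using v_nonzero by (simp add: p_def)
  next
    assume "?n \<bullet> y = 0"
    then obtain g where "p \<times> y = g *\<^sub>R ?n"
      using cross3_cross3_hyperplane n_nonzero n_v p_def by metis
    then have "p \<times> y + (- g) *\<^sub>R ?n = 0" by simp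
    then show "\<exists>g. p \<times> y + g *\<^sub>R ?n = 0" by blast
  qed
  ultimately show ?thesis by simp
qed

lemma equilibrium_force_load_imp_stress:
  assumes "equilibrium_force_load k P L F G" "nonzero_force_load k F G"
  obtains c :: "nat \<Rightarrow> real"
  where "\<And>j. c (j + k) = c j" "\<And>j. c (Suc j) * s (Suc j) = c j * t j" "\<exists>j. c j \<noteq> 0"
proof -
  have load: "has_line_of_force (F (j mod k) (Suc j mod k)) (edge_line k P (j mod k))"
      "F (j mod k) (Suc j mod k) = - F (Suc j mod k) (j mod k)"
      "has_line_of_force (G (j mod k)) (L (j mod k))" for j
    using assms(1) k_pos next_idx_mod[of k j]
    by (auto simp: equilibrium_force_load_def force_load_def dest!: spec[of _ "j mod k"])
  have equi: "F (Suc j mod k) (j mod k) + F (Suc j mod k) (Suc (Suc j) mod k)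
      + G (Suc j mod k) = 0" for j
    using assms(1) k_pos next_idx_mod[of k "Suc j"] prev_idx_Suc_mod[of k j]
    by (auto simp: equilibrium_force_load_def dest!: spec[of _ "Suc j mod k"])
  have "\<forall>j. \<exists>c. F (j mod k) (Suc j mod k) = cross_form (c *\<^sub>R edge_normal j)"
    using load(1) by (simp add: edge_force_iff)
  then obtain c0 where
    c0: "\<And>j. F (j mod k) (Suc j mod k) = cross_form (c0 j *\<^sub>R edge_normal j)" by metis
  \<comment> \<open>The chosen coefficients need not be periodic; reducing the index modulo
    \<open>k\<close> makes them so.\<close>
  define c where "c j = c0 (j mod k)" for j
  have c: "F (j mod k) (Suc j mod k) = cross_form (c j *\<^sub>R edge_normal j)" for j
    using c0[of "j mod k"] by (simp add: c_def edge_normal_mod mod_Suc_eq)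
  have eq0: "- cross_form (c j *\<^sub>R edge_normal j)
      + cross_form (c (Suc j) *\<^sub>R edge_normal (Suc j)) + G (Suc j mod k) = 0" for j
    using equi[of j] load(2)[of j] c[of j] c[of "Suc j"] by simp
  have "c (Suc j) * s (Suc j) = c j * t j" for j
    using eq0[of j] load(3)[of "Suc j"] vertex_equilibrium_iff[of "c j" j "c (Suc j)"]
    by (auto simp: framing_force_iff)
  moreover have "\<exists>j. c j \<noteq> 0"
  \<comment> \<open>If all edge coefficients vanish, equilibrium forces the framing forces to vanish
    too, and the load is zero.\<close>
  proof (rule ccontr)
    assume "\<not> (\<exists>j. c j \<noteq> 0)"
    then have z: "c j = 0" for j by simp
    have z0: "cross_form (0 *\<^sub>R x) = 0" for x by simp
    have "F j (next_idx k j) = 0 \<and> G j = 0" if "j < k" for j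
    proof
      show "F j (next_idx k j) = 0"
        using c[of j] that next_idx_mod[of k j] by (simp add: z)
      have "G (Suc (j + k - 1) mod k) = 0"
        using eq0[of "j + k - 1"] by (simp add: z)
      then show "G j = 0" using that by simp
    qed
    then show False using assms(2) by (auto simp: nonzero_force_load_def)
  qed
  moreover have "c (j + k) = c j" for j by (simp add: c_def)
  ultimately show thesis using that by blast
qed

lemma stress_imp_equilibrium_force_load:
  fixes c :: "nat \<Rightarrow> real"
  assumes periodic: "\<And>j. c (j + k) = c j"
    and stress: "\<And>j. c (Suc j) * s (Suc j) = c j * t j"
    and nonzero: "\<exists>j. c j \<noteq> 0"
  shows "\<exists>F G. equilibrium_force_load k P L F G \<and> nonzero_force_load k F G"
proof -
  define E where "E j = cross_form (c j *\<^sub>R edge_normal j)" for j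
  have "\<forall>j. \<exists>g. - E j + E (Suc j) + cross_form (g *\<^sub>R n (Suc j)) = 0"
    unfolding E_def vertex_equilibrium_iff using stress by blast
  then obtain g where g: "\<And>j. - E j + E (Suc j) + cross_form (g j *\<^sub>R n (Suc j)) = 0"
    by metis
  have E_mod: "E (j mod k) = E j" for j
    using periodic_mod[of c k, OF periodic] by (simp add: E_def edge_normal_mod)
  \<comment> \<open>\<open>E a\<close> is the force along the edge leaving \<open>a\<close>. All
    other pairs are read as reversed edges, which is unambiguous because the predecessor of a vertex
    is not its successor.\<close>
  define F where "F a b = (if b = next_idx k a then E a else - E b)" for a b
  \<comment> \<open>\<open>g j\<close> balances the vertex after \<open>j\<close>, so the index
    moves back by one; adding \<open>k\<close> first keeps it a natural number.\<close>
  define G where "G j = cross_form (g (j + k - 1) *\<^sub>R n j)" for j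
  have F_next: "F (j mod k) (Suc j mod k) = E j" for j
    by (simp add: F_def next_idx_mod E_mod)
  have F_prev: "F (Suc j mod k) (j mod k) = - E j" for j
    using Suc_Suc_mod_neq[OF k, of j] by (simp add: F_def next_idx_mod E_mod)
  have idx: "j mod k = j" "Suc j mod k = next_idx k j" if "j < k" for j
    using that next_idx_mod[of k j] by simp_all
  have "force_load k P L F G"
    unfolding force_load_def
  proof (intro allI impI conjI)
    fix j assume j: "j < k"
    show "has_line_of_force (F j (next_idx k j)) (edge_line k P j)"
      using F_next[of j] edge_force_iff[of "E j" j] j by (auto simp: idx E_def)
    show "F j (next_idx k j) = - F (next_idx k j) j"
      using F_next[of j] F_prev[of j] j by (simp add: idx)
    show "has_line_of_force (G j) (L j)"
      using framing_force_iff[of "G j" j] j by (auto simp: idx G_def)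
  qed
  moreover have "F j (prev_idx k j) + F j (next_idx k j) + G j = 0" if j: "j < k" for j
  proof -
    define r where "r = j + k - 1"
    have r: "Suc r = j + k" using k_pos by (simp add: r_def)
    then have "Suc r mod k = j" using j by simp
    then have "F j (prev_idx k j) = - E r"
      using F_prev[of r] prev_idx_Suc_mod[OF k_pos, of r] by simp
    moreover have "F j (next_idx k j) = E (Suc r)"
      using F_next[of j] j E_mod[of "Suc r"] \<open>Suc r mod k = j\<close> by (simp add: idx)
    moreover have "G j = cross_form (g r *\<^sub>R n (Suc r))"
      unfolding r by (simp add: G_def r_def n_periodic)
    ultimately show ?thesis using g[of r] by simp
  qed
  moreover have "nonzero_force_load k F G"
  proof -
    obtain j where "c j \<noteq> 0" using nonzero by blast
    then have "E j \<noteq> 0" by (simp add: E_def edge_normal_nonzero)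
    then have "F (j mod k) (next_idx k (j mod k)) \<noteq> 0"
      using F_next[of j] by (simp add: next_idx_mod)
    then show ?thesis unfolding nonzero_force_load_def using k_pos by (meson mod_less_divisor)
  qed
  ultimately show ?thesis unfolding equilibrium_force_load_def by blast
qed

section \<open>Solving the recurrence around the cycle\<close>

lemma stress_imp_prod_eq_1:
  fixes c :: "nat \<Rightarrow> real"
  assumes periodic: "\<And>j. c (j + k) = c j"
    and stress: "\<And>j. c (Suc j) * s (Suc j) = c j * t j"
    and nonzero: "\<exists>j. c j \<noteq> 0"
    and i: "i < k"
  shows "(\<Prod>u<k. s (i + u) / t (i + u)) = 1"
proof -
  \<comment> \<open>The recurrence telescopes: this quantity does not depend on \<open>N\<close>. At
    \<open>N = k\<close>, periodicity leaves the full product as the only factor to compare.\<close>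
  have step: "c (i + N) * s (i + N) * (\<Prod>u<N. s (i + u) / t (i + u)) = c i * s i" for N
  proof (induction N)
    case (Suc N)
    have "c (i + Suc N) * s (i + Suc N) = c (i + N) * t (i + N)"
      using stress[of "i + N"] by simp
    then show ?case using Suc t_nonzero[of "i + N"] by (simp add: field_simps)
  qed simp
  \<comment> \<open>As every \<open>s\<close> is nonzero, one vanishing coefficient would propagate
    to all later indices, hence around the whole cycle.\<close>
  have "c i \<noteq> 0"
  proof
    assume "c i = 0"
    have zero: "c (i + N) = 0" for N
    proof (induction N)
      case (Suc N)
      then show ?case using stress[of "i + N"] s_nonzero[of "Suc (i + N)"] by simp
    qed (simp add: \<open>c i = 0\<close>)
    obtain j where "c j \<noteq> 0" using nonzero by blast
    moreover have "c (j mod k) = c j" using periodic by (rule periodic_mod)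
    moreover have "c (j mod k + k) = c (j mod k)" by (rule periodic)
    moreover have "j mod k + k = i + (j mod k + k - i)" using i by simp
    ultimately show False using zero by metis
  qed
  then show ?thesis
    using step[of k] s_nonzero[of i] by (simp add: periodic s_periodic)
qed

lemma prod_eq_1_imp_stress:
  assumes prod: "(\<Prod>u<k. s (i + u) / t (i + u)) = 1" and i: "i < k"
  obtains c :: "nat \<Rightarrow> real"
  where "\<And>j. c (j + k) = c j" "\<And>j. c (Suc j) * s (Suc j) = c j * t j" "\<exists>j. c j \<noteq> 0"
proof -
  define E where "E N = (\<Prod>u<N. t (i + u) / s (i + u))" for N
  \<comment> \<open>\<open>E\<close> starts its product at vertex \<open>i\<close>, so
    \<open>E (j + (k - i))\<close> is its value at \<open>j\<close>, one period later to avoid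
    negative indices. Dividing by \<open>s j\<close> makes the recurrence for \<open>c\<close> the
    product rule for \<open>E\<close>.\<close>
  define c where "c j = E (j + (k - i)) / s j" for j
  have E_Suc: "E (Suc N) = E N * (t (i + N) / s (i + N))" for N
    by (simp add: E_def)
  have "E k * (\<Prod>u<k. s (i + u) / t (i + u)) = 1"
    unfolding E_def prod.distrib[symmetric] using s_nonzero t_nonzero by simp
  \<comment> \<open>The hypothesis on the product enters here: it is what lets the solution close up
    after one turn.\<close>
  then have "E k = 1" by (simp add: prod)
  have E_periodic: "E (N + k) = E N" for N
  proof (induction N)
    case 0
    show ?case by (simp add: \<open>E k = 1\<close>) (simp add: E_def)
  next
    case (Suc N)
    then show ?case
      using E_Suc[of "N + k"] s_periodic[of "i + N"] t_periodic[of "i + N"]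
      by (simp add: E_Suc add.assoc)
  qed
  have E_nonzero: "E N \<noteq> 0" for N
    using s_nonzero t_nonzero by (simp add: E_def)
  have "c (j + k) = c j" for j
    using E_periodic[of "j + (k - i)"] by (simp add: c_def s_periodic add.commute add.left_commute)
  moreover have "c (Suc j) * s (Suc j) = c j * t j" for j
  proof -
    have "i + (j + (k - i)) = j + k" using i by simp
    then have "E (Suc (j + (k - i))) = E (j + (k - i)) * (t j / s j)"
      by (simp add: E_Suc s_periodic t_periodic)
    then show ?thesis using s_nonzero[of "Suc j"] by (simp add: c_def)
  qed
  moreover have "c 0 \<noteq> 0" using E_nonzero s_nonzero by (simp add: c_def)
  ultimately show thesis using that by blast
qed

theorem trivial_monodromy_iff_equilibrium:
  assumes "i < k"
  shows "trivial_monodromy k P L l i \<longleftrightarrow>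
    (\<exists>F G. equilibrium_force_load k P L F G \<and> nonzero_force_load k F G)"
  unfolding trivial_monodromy_iff[OF assms]
proof
  assume "(\<Prod>u<k. s (i + u) / t (i + u)) = 1"
  then obtain c :: "nat \<Rightarrow> real" where "\<And>j. c (j + k) = c j"
      "\<And>j. c (Suc j) * s (Suc j) = c j * t j" "\<exists>j. c j \<noteq> 0"
    using assms by (rule prod_eq_1_imp_stress) blast
  then show "\<exists>F G. equilibrium_force_load k P L F G \<and> nonzero_force_load k F G"
    by (rule stress_imp_equilibrium_force_load)
next
  assume "\<exists>F G. equilibrium_force_load k P L F G \<and> nonzero_force_load k F G"
  then obtain F G where "equilibrium_force_load k P L F G" "nonzero_force_load k F G"
    by blast
  then obtain c :: "nat \<Rightarrow> real" where "\<And>j. c (j + k) = c j"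
      "\<And>j. c (Suc j) * s (Suc j) = c j * t j" "\<exists>j. c j \<noteq> 0"
    by (rule equilibrium_force_load_imp_stress) blast
  then show "(\<Prod>u<k. s (i + u) / t (i + u)) = 1"
    using assms by (rule stress_imp_prod_eq_1)
qed

end

section \<open>Normalisation in general position\<close>

text \<open>If two edges shared a line, every one of its infinitely many points would be an edge
  intersection.\<close>

lemma edge_lines_distinct:
  assumes "general_position k P L" "r < k" "s < k" "r \<noteq> s"
  shows "edge_line k P r \<noteq> edge_line k P s"
proof
  assume "edge_line k P r = edge_line k P s"
  then have "{x. proj_point x \<and> x \<subseteq> edge_line k P r} \<subseteq> edge_intersections k P"
    using assms by (auto simp: edge_intersections_def)
  moreover have "finite (edge_intersections k P)" "proj_line (edge_line k P r)"
    using assms by (auto simp: general_position_def)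
  ultimately show False using infinite_points_on_line finite_subset by blast
qed

text \<open>A common vector outside \<open>span {p}\<close> would span, together with
  \<open>p\<close>, both \<open>d\<close> and \<open>e\<close>.\<close>

lemma lines_inter_eq_point:
  assumes "proj_line d" "proj_line e" "d \<noteq> e" "p \<noteq> 0" "p \<in> d" "p \<in> e"
  shows "d \<inter> e = span {p}"
proof (intro equalityI subsetI)
  fix x assume x: "x \<in> d \<inter> e"
  show "x \<in> span {p}"
  proof (rule ccontr)
    assume "x \<notin> span {p}"
    then have "p \<times> x \<noteq> 0"
      using cross3_eq_0_imp_scaleR[of p x] assms by (auto simp: span_singleton)
    then have px: "proj_line (span {p, x})" by (rule proj_line_span)
    have "span {p, x} = f" if "proj_line f" "p \<in> f" "x \<in> f" for f
    proof (rule subspace_dim_equal)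
      show "span {p, x} \<subseteq> f"
        using that by (intro span_minimal) (auto simp: proj_line_def)
    qed (use that px in \<open>auto simp: proj_line_def\<close>)
    then show False using assms x by auto
  qed
next
  fix x assume "x \<in> span {p}"
  then show "x \<in> d \<inter> e"
    using assms by (auto simp: span_singleton proj_line_def subspace_scale)
qed

theorem theorem3p13:
  fixes k i :: nat
    and P L :: "nat \<Rightarrow> (real^3) set"
    and l :: "(real^3) set"
  assumes "k \<ge> 3"
    and "framed_cycle k P L"
    and "general_position k P L"
    and "proj_line l"
    and "\<forall>r<k. \<forall>s<k. r \<noteq> s \<longrightarrow> \<not> edge_line k P r \<inter> edge_line k P s \<subseteq> l"
    and "i < k"
  shows "trivial_monodromy k P L l i \<longleftrightarrow>
    (\<exists>F G. equilibrium_force_load k P L F G \<and> nonzero_force_load k F G)"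
proof -
  have k_pos: "k > 0" using assms(1) by simp
  obtain m where m: "l = {x. m \<bullet> x = 0}"
    using assms(4) by (rule proj_line_hyperplane)
  have "\<forall>j. j < k \<longrightarrow> (\<exists>p. p \<noteq> 0 \<and> P j = span {p})"
    using assms(2) by (auto simp: framed_cycle_def proj_point_iff)
  then obtain p where p: "\<And>j. j < k \<Longrightarrow> p j \<noteq> 0" "\<And>j. j < k \<Longrightarrow> P j = span {p j}"
    by metis
  have L_line: "proj_line (L j)" if "j < k" for j
    using assms(2) that by (simp add: framed_cycle_def)
  then have "\<forall>j. j < k \<longrightarrow> (\<exists>n. L j = {x. n \<bullet> x = 0})"
    by (metis proj_line_hyperplane)
  then obtain n where n: "\<And>j. j < k \<Longrightarrow> L j = {x. n j \<bullet> x = 0}" by metis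
  have framing: "\<not> P (prev_idx k j) \<subseteq> L j" "\<not> P (next_idx k j) \<subseteq> L j" if "j < k" for j
    using assms(3) that by (simp_all add: general_position_def)
  have P_subset: "P a \<subseteq> L b \<longleftrightarrow> n b \<bullet> p a = 0" if "a < k" "b < k" for a b
    using that by (simp add: p n span_singleton_subset_hyperplane)
  \<comment> \<open>No vertex lies on \<open>l\<close>: each is the intersection point of its two
    adjacent edges, which \<open>l\<close> avoids by hypothesis.\<close>
  have m_p: "m \<bullet> p (Suc j mod k) \<noteq> 0" for j
  proof -
    let ?j = "Suc j mod k"
    have lt: "j mod k < k" "?j < k" "Suc ?j mod k < k" using k_pos by simp_all
    have neq: "j mod k \<noteq> ?j"
      using assms(1) by (simp add: mod_Suc)
    have "edge_line k P (j mod k) = span {p (j mod k), p ?j}"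
      "edge_line k P ?j = span {p ?j, p (Suc ?j mod k)}"
      using p(2)[OF lt(1)] p(2)[OF lt(2)] p(2)[OF lt(3)]
      by (simp_all add: edge_line_def next_idx_mod line_through_span mod_Suc_eq)
    then have "p ?j \<in> edge_line k P (j mod k)" "p ?j \<in> edge_line k P ?j"
      by (simp_all add: span_base)
    moreover have "proj_line (edge_line k P (j mod k))" "proj_line (edge_line k P ?j)"
      using assms(3) lt by (simp_all add: general_position_def)
    ultimately have "edge_line k P (j mod k) \<inter> edge_line k P ?j = span {p ?j}"
      using edge_lines_distinct[OF assms(3) lt(1,2) neq] p(1)[OF lt(2)]
      by (intro lines_inter_eq_point)
    then have "\<not> span {p ?j} \<subseteq> l" using assms(5) lt neq by metis
    then show ?thesis by (simp add: m span_singleton_subset_hyperplane)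
  qed
  \<comment> \<open>Rescaling places the representatives in the affine plane
    \<open>m \<bullet> x = 1\<close>, and the reduced index makes the family periodic.\<close>
  define v where "v j = (1 / (m \<bullet> p (j mod k))) *\<^sub>R p (j mod k)" for j
  have m_p': "m \<bullet> p (j mod k) \<noteq> 0" for j
    using m_p[of "j + k - 1"] k_pos by simp
  interpret normalised_framed_cycle k v "\<lambda>j. n (j mod k)" m P L l
  proof
    fix j
    have lt: "j mod k < k" "Suc j mod k < k" using k_pos by simp_all
    show "m \<bullet> v j = 1" using m_p' by (simp add: v_def)
    show "n (j mod k) \<bullet> v j = 0"
      using assms(2) lt P_subset[of "j mod k" "j mod k"] by (simp add: v_def framed_cycle_def)
    show "n (j mod k) \<bullet> v (Suc j) \<noteq> 0"
      using framing(2)[OF lt(1)] lt P_subset[of "Suc j mod k" "j mod k"] m_p'[of "Suc j"]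
      by (simp add: v_def next_idx_mod)
    show "n (Suc j mod k) \<bullet> v j \<noteq> 0"
      using framing(1)[OF lt(2)] lt P_subset[of "j mod k" "Suc j mod k"] m_p'[of j]
      by (simp add: v_def prev_idx_Suc_mod k_pos)
    show "P j = span {v j}" if "j < k"
    proof -
      have "span {p j} = span {v j}"
      proof (intro equalityI span_minimal)
        have "p j = (m \<bullet> p j) *\<^sub>R v j" using that m_p'[of j] by (simp add: v_def)
        then have "p j \<in> span {v j}" by (metis insertI1 span_base span_scale)
        then show "{p j} \<subseteq> span {v j}" by simp
        show "{v j} \<subseteq> span {p j}" using that by (simp add: v_def span_base span_scale)
      qed simp_all
      then show ?thesis using p that by simp
    qed
    show "L j = {x. n (j mod k) \<bullet> x = 0}" if "j < k" using n that by simp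
  qed (use assms(1) m L_line in \<open>simp_all add: v_def\<close>)
  show ?thesis using assms(6) by (rule trivial_monodromy_iff_equilibrium)
qed

end
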